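(* For every real $z>0$, \[ \tanh z=\frac{8z}{\pi^2}\sum_{n=1,3,5,\ldots}\frac{1}{n^2+4z^2/\pi^2}, \] where the sum is over all positive odd integers $n$. *)

theory Defs
  imports "HOL-Analysis.Analysis"
begin

end

theory Submission
  imports Defs
begin

text \<open>
  The series is the logarithmic derivative of Euler's reflection formula
  \<open>\<Gamma>(w) \<Gamma>(1 - w) = \<pi> / sin(\<pi>w)\<close>, read off on the line \<open>Re w = 1/2\<close>. Differentiating the
  logarithm gives \<open>\<psi>(1 - w) - \<psi>(w) = \<pi> cot(\<pi>w)\<close> (lemma \<open>Digamma_reflection\<close>), and the series
  defining \<open>\<psi>\<close> turns the left-hand side into the sum over \<open>k \<ge> 0\<close> of
  \<open>1 / (w + k) - 1 / (1 - w + k)\<close>.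

  At \<open>w = 1/2 + \<i>y\<close> with \<open>y\<close> real, the two denominators are complex conjugates, so every term is
  \<open>-2\<i>y / ((k + 1/2)\<^sup>2 + y\<^sup>2)\<close>, and the cotangent, shifted by half its period, is
  \<open>-\<i> tanh(\<pi>y)\<close>. The factor \<open>-\<i>\<close> cancels and leaves a real series for \<open>\<pi> tanh(\<pi>y)\<close>. Clearing the
  halves by \<open>n = 2k + 1\<close> and putting \<open>y = z/\<pi>\<close> gives the claim.
\<close>

text \<open>
  Where \<open>w\<close> is no integer, \<open>\<Gamma>(w) \<Gamma>(1 - w) sin(\<pi>w)\<close> is locally the constant \<open>\<pi>\<close>, so its derivative
  vanishes. Since \<open>\<Gamma>' = \<Gamma>\<psi>\<close> and \<open>\<Gamma>\<close> has no zeros, the Gamma factors can be divided out.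
\<close>

lemma Digamma_reflection:
  fixes w :: complex
  assumes w: "w \<notin> \<int>"
  shows "Digamma (1 - w) - Digamma w = of_real pi * cot (of_real pi * w)"
proof -
  have w': "1 - w \<notin> \<int>"
    using w Ints_diff[of 1 "1 - w"] by auto
  have np: "w \<notin> \<int>\<^sub>\<le>\<^sub>0" "1 - w \<notin> \<int>\<^sub>\<le>\<^sub>0"
    using w w' nonpos_Ints_subset_Ints by blast+
  have sin_nz: "sin (of_real pi * u) \<noteq> 0" if "u \<notin> \<int>" for u :: complex
    using that by (auto simp: sin_eq_0 mult.commute[of "of_real pi"])
  let ?P = "Gamma w * Gamma (1 - w)"
  let ?D = "?P * ((Digamma w - Digamma (1 - w)) * sin (of_real pi * w)
              + of_real pi * cos (of_real pi * w))"
  have "((\<lambda>u. Gamma u * Gamma (1 - u) * sin (of_real pi * u)) has_field_derivative ?D) (at w)"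
    using np by (auto intro!: derivative_eq_intros simp: algebra_simps)
  moreover have "((\<lambda>u. Gamma u * Gamma (1 - u) * sin (of_real pi * u))
                    has_field_derivative 0) (at w)"
  proof (rule has_field_derivative_transform_within_open)
    show "((\<lambda>u. of_real pi :: complex) has_field_derivative 0) (at w)"
      by simp
    show "open (- (\<int> :: complex set))"
      using closed_Ints by auto
    show "w \<in> - \<int>"
      using w by simp
    show "of_real pi = Gamma u * Gamma (1 - u) * sin (of_real pi * u)" if "u \<in> - \<int>" for u :: complex
      using sin_nz[of u] that by (simp add: Gamma_reflection_complex)
  qed
  ultimately have "?D = 0"
    by (rule DERIV_unique)
  moreover have "?P \<noteq> 0"
    using np by (simp add: Gamma_eq_zero_iff)
  ultimately have "(Digamma w - Digamma (1 - w)) * sin (of_real pi * w)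
                     + of_real pi * cos (of_real pi * w) = 0"
    by (simp only: mult_eq_0_iff) simp
  thus ?thesis
    using sin_nz[OF w] by (simp add: cot_def field_simps)
qed

text \<open>
  Neither series defining \<open>\<psi>(w)\<close> and \<open>\<psi>(1 - w)\<close> converges without its compensating terms \<open>1/(k + 1)\<close>;
  these, like the Euler--Mascheroni constant, cancel in the difference.
\<close>

lemma cot_partial_fractions:
  fixes w :: complex
  assumes w: "w \<notin> \<int>"
  shows "(\<lambda>k. 1 / (w + of_nat k) - 1 / (1 - w + of_nat k)) sums (of_real pi * cot (of_real pi * w))"
proof -
  have sums_Digamma: "(\<lambda>k. inverse (of_nat (Suc k)) - inverse (u + of_nat k))
                        sums (Digamma u + euler_mascheroni)" if "u \<noteq> 0" for u :: complex
    using summable_Digamma[OF that] by (simp add: Digamma_def summable_sums)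
  have nz: "w \<noteq> 0" "1 - w \<noteq> 0"
    using w by auto
  from sums_diff[OF sums_Digamma[OF nz(2)] sums_Digamma[OF nz(1)]]
  show ?thesis
    by (simp add: Digamma_reflection[OF w] inverse_eq_divide)
qed

text \<open>
  The previous expansion at \<open>w = 1/2 + \<i>y\<close>, with numerator and denominator of every term multiplied
  by \<open>4\<close> so that the odd integers \<open>2k + 1\<close> appear.
\<close>

lemma tanh_partial_fractions:
  fixes y :: real
  shows "(\<lambda>k. 8 * y / (real (2 * k + 1) ^ 2 + 4 * y ^ 2)) sums (pi * tanh (pi * y))"
proof -
  define w where "w = 1 / 2 + \<i> * of_real y"
  have "w \<notin> \<int>"
  proof
    assume "w \<in> \<int>"
    then obtain n where "w = of_int n"
      by (auto elim: Ints_cases)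
    hence "1 / 2 = real_of_int n"
      by (simp add: w_def complex_eq_iff)
    hence "real_of_int (2 * n) = real_of_int 1"
      by simp
    hence "2 * n = 1"
      by (subst (asm) of_int_eq_iff)
    thus False
      by presburger
  qed
  have "cot (of_real pi * w) = - tan (\<i> * of_real (pi * y))"
    by (simp add: w_def cot_def tan_def ring_distribs sin_add cos_add mult_ac
          flip: of_real_divide)
  also have "\<dots> = - (\<i> * tanh (of_real (pi * y)))"
    by (simp add: tanh_conv_tan)
  also have "tanh (of_real (pi * y) :: complex) = of_real (tanh (pi * y))"
    by (simp add: tanh_altdef flip: exp_of_real)
  finally have cot: "of_real pi * cot (of_real pi * w) = - \<i> * of_real (pi * tanh (pi * y))"
    by simp
  have summand: "1 / (w + of_nat k) - 1 / (1 - w + of_nat k) =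
                - \<i> * of_real (8 * y / (real (2 * k + 1) ^ 2 + 4 * y ^ 2))" for k
  proof -
    have nz: "w + of_nat k \<noteq> 0" "1 - w + of_nat k \<noteq> 0"
      by (auto simp: w_def complex_eq_iff)
    have "1 / (w + of_nat k) - 1 / (1 - w + of_nat k) =
            ((1 - w + of_nat k) - (w + of_nat k)) / ((w + of_nat k) * (1 - w + of_nat k))"
      using nz by (simp add: diff_frac_eq)
    also have "(1 - w + of_nat k) - (w + of_nat k) = - \<i> * of_real (2 * y)"
      by (simp add: w_def complex_eq_iff)
    also have "(w + of_nat k) * (1 - w + of_nat k) =
                 of_real ((real (2 * k + 1) ^ 2 + 4 * y ^ 2) / 4)"
      by (simp add: w_def complex_eq_iff power2_eq_square field_simps)
    also have "- \<i> * of_real (2 * y) / of_real ((real (2 * k + 1) ^ 2 + 4 * y ^ 2) / 4) =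
                 - \<i> * complex_of_real (8 * y / (real (2 * k + 1) ^ 2 + 4 * y ^ 2))"
      by simp
    finally show ?thesis .
  qed
  from sums_mult[OF cot_partial_fractions[OF \<open>w \<notin> \<int>\<close>], of \<i>]
  have "(\<lambda>k. complex_of_real (8 * y / (real (2 * k + 1) ^ 2 + 4 * y ^ 2)))
          sums of_real (pi * tanh (pi * y))"
    unfolding summand cot by (simp add: mult.assoc[symmetric] del: of_real_mult of_real_divide)
  thus ?thesis
    by (subst (asm) sums_of_real_iff)
qed

theorem corollary2:
  fixes z :: real
  assumes "z > 0"
  shows "(\<lambda>n. 1 / ((real n)\<^sup>2 + 4 * z\<^sup>2 / pi\<^sup>2)) summable_on {n :: nat. odd n} \<and>
         tanh z = 8 * z / pi\<^sup>2 *
           (\<Sum>\<^sub>\<infinity>n\<in>{n :: nat. odd n}. 1 / ((real n)\<^sup>2 + 4 * z\<^sup>2 / pi\<^sup>2))"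
proof -
  let ?f = "\<lambda>n. 1 / ((real n)\<^sup>2 + 4 * z\<^sup>2 / pi\<^sup>2)"
  let ?S = "pi\<^sup>2 * tanh z / (8 * z)"
  have "(\<lambda>k. pi / (8 * z) * (8 * (z / pi) / (real (2 * k + 1) ^ 2 + 4 * (z / pi) ^ 2)))
          sums (pi / (8 * z) * (pi * tanh (pi * (z / pi))))"
    by (intro sums_mult tanh_partial_fractions)
  also have "(\<lambda>k. pi / (8 * z) * (8 * (z / pi) / (real (2 * k + 1) ^ 2 + 4 * (z / pi) ^ 2))) =
               (\<lambda>k. ?f (2 * k + 1))"
    using assms by (simp add: power_divide)
  also have "pi / (8 * z) * (pi * tanh (pi * (z / pi))) = ?S"
    by (simp add: power2_eq_square)
  \<comment> \<open>The terms are nonnegative, so the ordered series is also an unordered sum.\<close>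
  finally have "((\<lambda>k. ?f (2 * k + 1)) has_sum ?S) UNIV"
    by (rule sums_nonneg_imp_has_sum) simp
  moreover have "bij_betw (\<lambda>k. 2 * k + 1) UNIV {n :: nat. odd n}"
    by (auto simp: bij_betw_def inj_on_def elim: oddE)
  ultimately have "(?f has_sum ?S) {n. odd n}"
    by (subst (asm) has_sum_reindex_bij_betw)
  thus ?thesis
    using assms by (auto simp: has_sum_imp_summable infsumI)
qed

end
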